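(* Let $A$ be a $\Delta$-separable Frobenius algebra in a symmetric strict monoidal category whose Nakayama automorphism $N$ is an involution, and suppose the idempotent $P^{NS}=\mu\circ\sigma_{A,A}\circ(N\otimes\mathrm{id}_A)\circ\Delta$ on $A$ is split, with image $Z^{NS}(A)$ and embedding $\iota^{NS}:Z^{NS}(A)\to A$. Then $Z^{NS}(A)$ together with $\iota^{NS}$ is the centre of $A$.
   Context: $\sigma_{U,V}$ is the symmetric braiding. A Frobenius algebra is an object $A$ with a unital associative algebra structure $(\mu,\eta)$ and a counital coassociative coalgebra structure $(\Delta,\varepsilon)$ such that $(\mathrm{id}\otimes\mu)(\Delta\otimes\mathrm{id})=\Delta\mu=(\mu\otimes\mathrm{id})(\mathrm{id}\otimes\Delta)$. Put $b=\varepsilon\circ\mu$. The Nakayama automorphism is $N=(b\otimes\mathrm{id}_A)\circ(\mathrm{id}_A\otimes\sigma_{A,A})\circ(\mathrm{id}_A\otimes(\Delta\circ\eta))$. $A$ is $\Delta$-separable if $\mu\circ\Delta\circ\eta=\eta$ (equivalently $\mu\circ\Delta=\mathrm{id}_A$). A splitting of $P^{NS}$ consists of $\iota^{NS}:Z^{NS}(A)\to A$, $\pi^{NS}:A\to Z^{NS}(A)$ with $\iota^{NS}\pi^{NS}=P^{NS}$ and $\pi^{NS}\iota^{NS}=\mathrm{id}$. A centre of an algebra $A$ is an object $C$ with a morphism $c:C\to A$ such that (1) $\mu\circ\sigma_{A,A}\circ(c\otimes\mathrm{id})$ $=\mu\circ(c\otimes\mathrm{id})$, where in the braided term the composite means $C\otimes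 A\xrightarrow{c\otimes\mathrm{id}}A\otimes A\xrightarrow{\sigma_{A,A}}A\otimes A\xrightarrow{\mu}A$; and (2) for every $d:D\to A$ with $\mu\circ\sigma_{A,A}\circ(d\otimes\mathrm{id})=\mu\circ(d\otimes\mathrm{id})$ there is a unique $f:D\to C$ with $d=c\circ f$. *)

theory Defs
  imports Main
begin

section \<open>Symmetric strict monoidal categories\<close>

text \<open>
  Objects and morphisms are elements of explicit carriers, so that the strictness laws are
  literal equations between objects and between morphisms. The operations are total functions
  whose values are only constrained on the carriers and on composable pairs.
  The term \<open>g \<odot> f\<close> is the composite ``first \<open>f\<close>, then \<open>g\<close>''.
\<close>

record ('o, 'm) category =
  Obj :: "'o set"
  Mor :: "'m set"
  Dom :: "'m \<Rightarrow> 'o"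
  Cod :: "'m \<Rightarrow> 'o"
  Id :: "'o \<Rightarrow> 'm" ("\<one>\<index>")
  Comp :: "'m \<Rightarrow> 'm \<Rightarrow> 'm" (infixr "\<odot>\<index>" 55)

record ('o, 'm) monoidal_category = "('o, 'm) category" +
  UnitObj :: "'o" ("\<I>\<index>")
  TensorObj :: "'o \<Rightarrow> 'o \<Rightarrow> 'o" (infixr "\<otimes>\<^sub>o\<index>" 70)
  Tensor :: "'m \<Rightarrow> 'm \<Rightarrow> 'm" (infixr "\<otimes>\<index>" 70)

record ('o, 'm) braided_category = "('o, 'm) monoidal_category" +
  Braiding :: "'o \<Rightarrow> 'o \<Rightarrow> 'm" ("\<sigma>\<index>")

definition Hom :: "('o, 'm, 'z) category_scheme \<Rightarrow> 'o \<Rightarrow> 'o \<Rightarrow> 'm set" where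
  "Hom C U V = {f \<in> Mor C. Dom C f = U \<and> Cod C f = V}"

locale category =
  fixes C :: "('o, 'm, 'z) category_scheme" (structure)
  assumes Dom_Obj: "f \<in> Mor C \<Longrightarrow> Dom C f \<in> Obj C"
    and Cod_Obj: "f \<in> Mor C \<Longrightarrow> Cod C f \<in> Obj C"
    and Id_Hom: "U \<in> Obj C \<Longrightarrow> \<one> U \<in> Hom C U U"
    and Comp_Hom: "\<lbrakk>f \<in> Hom C U V; g \<in> Hom C V W\<rbrakk> \<Longrightarrow> g \<odot> f \<in> Hom C U W"
    and Comp_Id_right: "f \<in> Hom C U V \<Longrightarrow> f \<odot> \<one> U = f"
    and Comp_Id_left: "f \<in> Hom C U V \<Longrightarrow> \<one> V \<odot> f = f"
    and Comp_assoc: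
      "\<lbrakk>f \<in> Hom C U V; g \<in> Hom C V W; h \<in> Hom C W X\<rbrakk> \<Longrightarrow> (h \<odot> g) \<odot> f = h \<odot> (g \<odot> f)"

locale strict_monoidal_category = category C
  for C :: "('o, 'm, 'z) monoidal_category_scheme" (structure) +
  assumes Unit_Obj: "\<I> \<in> Obj C"
    and TensorObj_Obj: "\<lbrakk>U \<in> Obj C; V \<in> Obj C\<rbrakk> \<Longrightarrow> U \<otimes>\<^sub>o V \<in> Obj C"
    and TensorObj_assoc:
      "\<lbrakk>U \<in> Obj C; V \<in> Obj C; W \<in> Obj C\<rbrakk> \<Longrightarrow> (U \<otimes>\<^sub>o V) \<otimes>\<^sub>o W = U \<otimes>\<^sub>o (V \<otimes>\<^sub>o W)"
    and TensorObj_unit_left: "U \<in> Obj C \<Longrightarrow> \<I> \<otimes>\<^sub>o U = U"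
    and TensorObj_unit_right: "U \<in> Obj C \<Longrightarrow> U \<otimes>\<^sub>o \<I> = U"
    and Tensor_Hom:
      "\<lbrakk>f \<in> Hom C U V; g \<in> Hom C U' V'\<rbrakk> \<Longrightarrow> f \<otimes> g \<in> Hom C (U \<otimes>\<^sub>o U') (V \<otimes>\<^sub>o V')"
    and Tensor_Id: "\<lbrakk>U \<in> Obj C; V \<in> Obj C\<rbrakk> \<Longrightarrow> \<one> U \<otimes> \<one> V = \<one> (U \<otimes>\<^sub>o V)"
    and Tensor_Comp:
      "\<lbrakk>f \<in> Hom C U V; g \<in> Hom C V W; f' \<in> Hom C U' V'; g' \<in> Hom C V' W'\<rbrakk>
       \<Longrightarrow> (g \<odot> f) \<otimes> (g' \<odot> f') = (g \<otimes> g') \<odot> (f \<otimes> f')"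
    and Tensor_assoc:
      "\<lbrakk>f \<in> Mor C; g \<in> Mor C; h \<in> Mor C\<rbrakk> \<Longrightarrow> (f \<otimes> g) \<otimes> h = f \<otimes> (g \<otimes> h)"
    and Tensor_unit_left: "f \<in> Mor C \<Longrightarrow> \<one> \<I> \<otimes> f = f"
    and Tensor_unit_right: "f \<in> Mor C \<Longrightarrow> f \<otimes> \<one> \<I> = f"

locale symmetric_strict_monoidal_category = strict_monoidal_category C
  for C :: "('o, 'm, 'z) braided_category_scheme" (structure) +
  assumes Braiding_Hom:
      "\<lbrakk>U \<in> Obj C; V \<in> Obj C\<rbrakk> \<Longrightarrow> \<sigma> U V \<in> Hom C (U \<otimes>\<^sub>o V) (V \<otimes>\<^sub>o U)"
    and Braiding_natural:
      "\<lbrakk>f \<in> Hom C U U'; g \<in> Hom C V V'\<rbrakk> \<Longrightarrow> \<sigma> U' V' \<odot> (f \<otimes> g) = (g \<otimes> f) \<odot> \<sigma> U V"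
    and Braiding_hexagon1:
      "\<lbrakk>U \<in> Obj C; V \<in> Obj C; W \<in> Obj C\<rbrakk>
       \<Longrightarrow> \<sigma> U (V \<otimes>\<^sub>o W) = (\<one> V \<otimes> \<sigma> U W) \<odot> (\<sigma> U V \<otimes> \<one> W)"
    and Braiding_hexagon2:
      "\<lbrakk>U \<in> Obj C; V \<in> Obj C; W \<in> Obj C\<rbrakk>
       \<Longrightarrow> \<sigma> (U \<otimes>\<^sub>o V) W = (\<sigma> U W \<otimes> \<one> V) \<odot> (\<one> U \<otimes> \<sigma> V W)"
    and Braiding_symmetric:
      "\<lbrakk>U \<in> Obj C; V \<in> Obj C\<rbrakk> \<Longrightarrow> \<sigma> V U \<odot> \<sigma> U V = \<one> (U \<otimes>\<^sub>o V)"


section \<open>Frobenius algebras\<close>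

locale algebra_object = strict_monoidal_category C
  for C :: "('o, 'm, 'z) monoidal_category_scheme" (structure)
    and A :: 'o and \<mu> :: 'm and \<eta> :: 'm +
  assumes alg_Obj: "A \<in> Obj C"
    and mult_Hom: "\<mu> \<in> Hom C (A \<otimes>\<^sub>o A) A"
    and unit_Hom: "\<eta> \<in> Hom C \<I> A"
    and mult_assoc: "\<mu> \<odot> (\<mu> \<otimes> \<one> A) = \<mu> \<odot> (\<one> A \<otimes> \<mu>)"
    and mult_unit_left: "\<mu> \<odot> (\<eta> \<otimes> \<one> A) = \<one> A"
    and mult_unit_right: "\<mu> \<odot> (\<one> A \<otimes> \<eta>) = \<one> A"

locale coalgebra_object = strict_monoidal_category C
  for C :: "('o, 'm, 'z) monoidal_category_scheme" (structure)
    and A :: 'o and \<Delta> :: 'm and \<epsilon> :: 'm +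
  assumes coalg_Obj: "A \<in> Obj C"
    and comult_Hom: "\<Delta> \<in> Hom C A (A \<otimes>\<^sub>o A)"
    and counit_Hom: "\<epsilon> \<in> Hom C A \<I>"
    and comult_coassoc: "(\<Delta> \<otimes> \<one> A) \<odot> \<Delta> = (\<one> A \<otimes> \<Delta>) \<odot> \<Delta>"
    and comult_counit_left: "(\<epsilon> \<otimes> \<one> A) \<odot> \<Delta> = \<one> A"
    and comult_counit_right: "(\<one> A \<otimes> \<epsilon>) \<odot> \<Delta> = \<one> A"

locale frobenius_algebra = algebra_object C A \<mu> \<eta> + coalgebra_object C A \<Delta> \<epsilon>
  for C :: "('o, 'm, 'z) monoidal_category_scheme" (structure)
    and A :: 'o and \<mu> :: 'm and \<eta> :: 'm and \<Delta> :: 'm and \<epsilon> :: 'm +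
  assumes frobenius_left: "(\<one> A \<otimes> \<mu>) \<odot> (\<Delta> \<otimes> \<one> A) = \<Delta> \<odot> \<mu>"
    and frobenius_right: "\<Delta> \<odot> \<mu> = (\<mu> \<otimes> \<one> A) \<odot> (\<one> A \<otimes> \<Delta>)"

definition Delta_separable ::
    "('o, 'm, 'z) category_scheme \<Rightarrow> 'm \<Rightarrow> 'm \<Rightarrow> 'm \<Rightarrow> bool" where
  "Delta_separable C \<mu> \<eta> \<Delta> \<longleftrightarrow> \<mu> \<odot> \<Delta> \<odot> \<eta> = \<eta>" for C (structure)

definition frobenius_pairing ::
    "('o, 'm, 'z) category_scheme \<Rightarrow> 'm \<Rightarrow> 'm \<Rightarrow> 'm" where
  "frobenius_pairing C \<mu> \<epsilon> = \<epsilon> \<odot> \<mu>" for C (structure)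

definition nakayama ::
    "('o, 'm, 'z) braided_category_scheme \<Rightarrow> 'o \<Rightarrow> 'm \<Rightarrow> 'm \<Rightarrow> 'm \<Rightarrow> 'm \<Rightarrow> 'm" where
  "nakayama C A \<mu> \<eta> \<Delta> \<epsilon> =
     (frobenius_pairing C \<mu> \<epsilon> \<otimes> \<one> A) \<odot> (\<one> A \<otimes> \<sigma> A A) \<odot> (\<one> A \<otimes> (\<Delta> \<odot> \<eta>))"
  for C (structure)

definition P_NS ::
    "('o, 'm, 'z) braided_category_scheme \<Rightarrow> 'o \<Rightarrow> 'm \<Rightarrow> 'm \<Rightarrow> 'm \<Rightarrow> 'm \<Rightarrow> 'm" where
  "P_NS C A \<mu> \<eta> \<Delta> \<epsilon> = \<mu> \<odot> \<sigma> A A \<odot> (nakayama C A \<mu> \<eta> \<Delta> \<epsilon> \<otimes> \<one> A) \<odot> \<Delta>"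
  for C (structure)


section \<open>Split idempotents and centres\<close>

text \<open>The equations force \<open>P\<close> to be idempotent.\<close>

definition is_splitting ::
    "('o, 'm, 'z) category_scheme \<Rightarrow> 'o \<Rightarrow> 'm \<Rightarrow> 'o \<Rightarrow> 'm \<Rightarrow> 'm \<Rightarrow> bool" where
  "is_splitting C A P Z \<iota> \<pi> \<longleftrightarrow>
     \<iota> \<in> Hom C Z A \<and> \<pi> \<in> Hom C A Z \<and> \<iota> \<odot> \<pi> = P \<and> \<pi> \<odot> \<iota> = \<one> Z"
  for C (structure)

definition centralising ::
    "('o, 'm, 'z) braided_category_scheme \<Rightarrow> 'o \<Rightarrow> 'm \<Rightarrow> 'm \<Rightarrow> bool" where
  "centralising C A \<mu> d \<longleftrightarrow> \<mu> \<odot> \<sigma> A A \<odot> (d \<otimes> \<one> A) = \<mu> \<odot> (d \<otimes> \<one> A)"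
  for C (structure)

definition is_centre ::
    "('o, 'm, 'z) braided_category_scheme \<Rightarrow> 'o \<Rightarrow> 'm \<Rightarrow> 'o \<Rightarrow> 'm \<Rightarrow> bool" where
  "is_centre C A \<mu> Z c \<longleftrightarrow>
     c \<in> Hom C Z A \<and> centralising C A \<mu> c \<and>
     (\<forall>D \<in> Obj C. \<forall>d \<in> Hom C D A. centralising C A \<mu> d \<longrightarrow>
        (\<exists>!f. f \<in> Hom C D Z \<and> d = c \<odot> f))"
  for C (structure)

end

theory Submission
  imports Defs
begin

text \<open>
  Write \<open>\<theta> = \<Delta> \<odot> \<eta> = \<Sum> e \<otimes> f\<close>. The Frobenius relations give
  \<open>\<Delta> x = \<Sum> e \<otimes> f x = \<Sum> x e \<otimes> f\<close>, and the snake identity gives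
  \<open>\<Sum> e \<otimes> N f = \<Sum> f \<otimes> e\<close>. If \<open>N\<close> is an involution, it follows that
  \<open>\<Sum> f \<otimes> N e = \<Sum> e \<otimes> f\<close>, so that \<open>P\<^sup>N\<^sup>S x = \<Sum> f x (N e) = \<Sum> e x f\<close>.
  This is central because \<open>\<Sum> a e \<otimes> f = \<Sum> e \<otimes> f a\<close>, and it equals \<open>x\<close> for
  central \<open>x\<close> because \<open>\<Sum> e f = \<eta>\<close>.
\<close>

section \<open>Composition, and factoring through a split idempotent\<close>

context category
begin

lemma Hom_iff: "f \<in> Hom C U V \<longleftrightarrow> f \<in> Mor C \<and> Dom C f = U \<and> Cod C f = V"
  by (simp add: Hom_def)

text \<open>The middle object of a \<open>Hom\<close> premise is not visible in the composite.
  Typing by \<open>Dom\<close> and \<open>Cod\<close> lets the simplifier compute it.\<close>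

lemma Comp_type [simp]:
  assumes "f \<in> Mor C" "g \<in> Mor C" "Dom C g = Cod C f"
  shows "g \<odot> f \<in> Mor C" "Dom C (g \<odot> f) = Dom C f" "Cod C (g \<odot> f) = Cod C g"
  using Comp_Hom[of f "Dom C f" "Cod C f" g "Cod C g"] assms by (simp_all add: Hom_iff)

lemma Id_type [simp]:
  assumes "U \<in> Obj C"
  shows "\<one> U \<in> Mor C" "Dom C (\<one> U) = U" "Cod C (\<one> U) = U"
  using Id_Hom[OF assms] by (simp_all add: Hom_iff)

lemma Comp_Id [simp]:
  assumes "f \<in> Mor C"
  shows "Dom C f = U \<Longrightarrow> f \<odot> \<one> U = f" "Cod C f = V \<Longrightarrow> \<one> V \<odot> f = f"
  using assms Comp_Id_right Comp_Id_left by (auto simp: Hom_iff)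

lemma Comp_assoc':
  assumes "f \<in> Mor C" "g \<in> Mor C" "h \<in> Mor C" "Dom C g = Cod C f" "Dom C h = Cod C g"
  shows "(h \<odot> g) \<odot> f = h \<odot> g \<odot> f"
  using assms by (intro Comp_assoc) (auto simp: Hom_iff)

declare Dom_Obj [simp] Cod_Obj [simp]

text \<open>Since \<open>\<pi> \<odot> \<iota>\<close> is an identity, the only possible factor of
  \<open>d\<close> through \<open>\<iota>\<close> is \<open>\<pi> \<odot> d\<close>. It is one
  exactly when \<open>\<iota> \<odot> \<pi>\<close> fixes \<open>d\<close>.\<close>

lemma splitting_factor_iff:
  assumes split: "is_splitting C A P Z \<iota> \<pi>" and d: "d \<in> Hom C D A"
  shows "(\<exists>!f. f \<in> Hom C D Z \<and> d = \<iota> \<odot> f) \<longleftrightarrow> P \<odot> d = d"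
proof -
  have [simp]: "\<iota> \<in> Mor C" "Dom C \<iota> = Z" "Cod C \<iota> = A" "\<pi> \<in> Mor C" "Dom C \<pi> = A"
      "Cod C \<pi> = Z" "d \<in> Mor C" "Dom C d = D" "Cod C d = A"
    and P: "P = \<iota> \<odot> \<pi>" and r: "\<pi> \<odot> \<iota> = \<one> Z"
    using split d by (auto simp: is_splitting_def Hom_iff)
  have inv: "\<pi> \<odot> \<iota> \<odot> f = f" if "f \<in> Hom C D Z" for f
    using that by (simp add: Hom_iff r flip: Comp_assoc')
  have Pd: "P \<odot> d = \<iota> \<odot> \<pi> \<odot> d"
    by (simp add: P Comp_assoc')
  show ?thesis
  proof
    assume "\<exists>!f. f \<in> Hom C D Z \<and> d = \<iota> \<odot> f"
    then show "P \<odot> d = d"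
      using Pd inv by metis
  next
    assume "P \<odot> d = d"
    then have "\<pi> \<odot> d \<in> Hom C D Z \<and> d = \<iota> \<odot> \<pi> \<odot> d"
      using Pd by (simp add: Hom_iff)
    then show "\<exists>!f. f \<in> Hom C D Z \<and> d = \<iota> \<odot> f"
      using inv by metis
  qed
qed

end

section \<open>Interchange law and naturality of the braiding\<close>

context strict_monoidal_category
begin

declare Unit_Obj [simp] TensorObj_Obj [simp] TensorObj_assoc [simp]
  TensorObj_unit_left [simp] TensorObj_unit_right [simp]
  Tensor_unit_left [simp] Tensor_unit_right [simp] Tensor_assoc [simp]

lemma Tensor_type [simp]:
  assumes "f \<in> Mor C" "g \<in> Mor C"
  shows "f \<otimes> g \<in> Mor C" "Dom C (f \<otimes> g) = Dom C f \<otimes>\<^sub>o Dom C g"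
    "Cod C (f \<otimes> g) = Cod C f \<otimes>\<^sub>o Cod C g"
  using Tensor_Hom[of f "Dom C f" "Cod C f" g "Dom C g" "Cod C g"] assms
  by (simp_all add: Hom_iff)

lemma interchange:
  assumes "f \<in> Mor C" "g \<in> Mor C" "f' \<in> Mor C" "g' \<in> Mor C"
    and "Dom C g = Cod C f" "Dom C g' = Cod C f'"
  shows "(g \<otimes> g') \<odot> (f \<otimes> f') = (g \<odot> f) \<otimes> (g' \<odot> f')"
  using Tensor_Comp[of f "Dom C f" "Cod C f" g "Cod C g" f' "Dom C f'" "Cod C f'" g' "Cod C g'"]
    assms by (simp add: Hom_iff)

text \<open>In a right-nested composite two adjacent tensors do not form a subterm, so
  \<open>interchange\<close> needs a version with a tail \<open>h\<close>.\<close>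

lemma interchange_Comp:
  assumes "f \<in> Mor C" "g \<in> Mor C" "f' \<in> Mor C" "g' \<in> Mor C" "h \<in> Mor C"
    and "Dom C g = Cod C f" "Dom C g' = Cod C f'" "Dom C f \<otimes>\<^sub>o Dom C f' = Cod C h"
  shows "(g \<otimes> g') \<odot> (f \<otimes> f') \<odot> h = ((g \<odot> f) \<otimes> (g' \<odot> f')) \<odot> h"
  using assms by (simp flip: interchange Comp_assoc')

end

context symmetric_strict_monoidal_category
begin

lemma Braiding_type [simp]:
  assumes "U \<in> Obj C" "V \<in> Obj C"
  shows "\<sigma> U V \<in> Mor C" "Dom C (\<sigma> U V) = U \<otimes>\<^sub>o V" "Cod C (\<sigma> U V) = V \<otimes>\<^sub>o U"
  using Braiding_Hom[OF assms] by (simp_all add: Hom_iff)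

text \<open>The codomains are variables fixed by premises, so the left-hand side matches
  \<open>\<sigma> A A\<close> syntactically.\<close>

lemma Braiding_nat:
  assumes "f \<in> Mor C" "g \<in> Mor C" "Cod C f = U'" "Cod C g = V'"
  shows "\<sigma> U' V' \<odot> (f \<otimes> g) = (g \<otimes> f) \<odot> \<sigma> (Dom C f) (Dom C g)"
  using assms by (intro Braiding_natural) (simp_all add: Hom_iff)

end

section \<open>The copairing of a Frobenius algebra\<close>

context frobenius_algebra
begin

definition copairing :: 'm ("\<theta>") where
  "\<theta> = \<Delta> \<odot> \<eta>"

lemma structure_type [simp]:
  "A \<in> Obj C"
  "\<mu> \<in> Mor C" "Dom C \<mu> = A \<otimes>\<^sub>o A" "Cod C \<mu> = A"
  "\<eta> \<in> Mor C" "Dom C \<eta> = \<I>" "Cod C \<eta> = A"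
  "\<Delta> \<in> Mor C" "Dom C \<Delta> = A" "Cod C \<Delta> = A \<otimes>\<^sub>o A"
  "\<epsilon> \<in> Mor C" "Dom C \<epsilon> = A" "Cod C \<epsilon> = \<I>"
  using alg_Obj mult_Hom unit_Hom comult_Hom counit_Hom by (auto simp: Hom_iff)

lemma copairing_type [simp]: "\<theta> \<in> Mor C" "Dom C \<theta> = \<I>" "Cod C \<theta> = A \<otimes>\<^sub>o A"
  by (simp_all add: copairing_def)

text \<open>Expand x as 1 x and apply the left Frobenius relation to \<Delta> (1 x). The mirror
  version below expands x as x 1.\<close>

lemma comult_copairing_left: "(\<one> A \<otimes> \<mu>) \<odot> (\<theta> \<otimes> \<one> A) = \<Delta>"
proof -
  have "\<theta> \<otimes> \<one> A = (\<Delta> \<otimes> \<one> A) \<odot> (\<eta> \<otimes> \<one> A)"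
    by (simp add: copairing_def interchange)
  then have "(\<one> A \<otimes> \<mu>) \<odot> (\<theta> \<otimes> \<one> A) = ((\<one> A \<otimes> \<mu>) \<odot> (\<Delta> \<otimes> \<one> A)) \<odot> (\<eta> \<otimes> \<one> A)"
    by (simp add: Comp_assoc')
  also have "\<dots> = \<Delta> \<odot> \<mu> \<odot> (\<eta> \<otimes> \<one> A)"
    by (simp add: frobenius_left Comp_assoc')
  finally show ?thesis
    by (simp add: mult_unit_left)
qed

lemma comult_copairing_right: "(\<mu> \<otimes> \<one> A) \<odot> (\<one> A \<otimes> \<theta>) = \<Delta>"
proof -
  have "\<one> A \<otimes> \<theta> = (\<one> A \<otimes> \<Delta>) \<odot> (\<one> A \<otimes> \<eta>)"
    by (simp add: copairing_def interchange)
  then have "(\<mu> \<otimes> \<one> A) \<odot> (\<one> A \<otimes> \<theta>) = ((\<mu> \<otimes> \<one> A) \<odot> (\<one> A \<otimes> \<Delta>)) \<odot> (\<one> A \<otimes> \<eta>)"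
    by (simp add: Comp_assoc')
  also have "\<dots> = \<Delta> \<odot> \<mu> \<odot> (\<one> A \<otimes> \<eta>)"
    by (simp add: frobenius_right[symmetric] Comp_assoc')
  finally show ?thesis
    by (simp add: mult_unit_right)
qed

lemma snake: "(\<one> A \<otimes> (\<epsilon> \<odot> \<mu>)) \<odot> (\<theta> \<otimes> \<one> A) = \<one> A"
proof -
  have "\<one> A \<otimes> (\<epsilon> \<odot> \<mu>) = (\<one> A \<otimes> \<epsilon>) \<odot> (\<one> A \<otimes> \<mu>)"
    by (simp add: interchange)
  then show ?thesis
    by (simp add: Comp_assoc' comult_copairing_left comult_counit_right)
qed

text \<open>Two bracketings of a fourfold product: a ((b c) d) = ((a b) c) d.\<close>

lemma mult_mult_mult:
  "\<mu> \<odot> (\<one> A \<otimes> \<mu>) \<odot> (\<one> A \<otimes> \<mu> \<otimes> \<one> A) = \<mu> \<odot> (\<mu> \<otimes> \<one> A) \<odot> (\<mu> \<otimes> \<one> A \<otimes> \<one> A)"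
proof -
  have "\<mu> \<odot> (\<one> A \<otimes> \<mu>) \<odot> (\<one> A \<otimes> \<mu> \<otimes> \<one> A)
      = (\<mu> \<odot> (\<mu> \<otimes> \<one> A)) \<odot> ((\<one> A \<otimes> \<mu>) \<otimes> \<one> A)"
    by (simp add: mult_assoc Comp_assoc')
  \<comment> \<open>With \<open>Tensor_assoc\<close> removed, the last strand stays a separate right
    factor \<open>\<one> A\<close>, the shape in which \<open>interchange\<close> acts.\<close>
  also have "\<dots> = \<mu> \<odot> ((\<mu> \<odot> (\<one> A \<otimes> \<mu>)) \<otimes> \<one> A)"
    by (simp add: Comp_assoc' interchange del: Tensor_assoc)
  also have "\<dots> = \<mu> \<odot> ((\<mu> \<odot> (\<mu> \<otimes> \<one> A)) \<otimes> \<one> A)"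
    by (simp add: mult_assoc)
  also have "\<dots> = \<mu> \<odot> (\<mu> \<otimes> \<one> A) \<odot> ((\<mu> \<otimes> \<one> A) \<otimes> \<one> A)"
    by (simp add: interchange del: Tensor_assoc)
  finally show ?thesis
    by simp
qed

end

section \<open>The Nakayama automorphism and central morphisms\<close>

locale symmetric_frobenius_algebra =
  symmetric_strict_monoidal_category C + frobenius_algebra C A \<mu> \<eta> \<Delta> \<epsilon>
  for C :: "('o, 'm, 'z) braided_category_scheme" (structure)
    and A :: 'o and \<mu> \<eta> \<Delta> \<epsilon> :: 'm
begin

abbreviation N :: 'm where
  "N \<equiv> nakayama C A \<mu> \<eta> \<Delta> \<epsilon>"

text \<open>This is x \<mapsto> \<Sum> (e x) f; the braiding moves x between the legs of \<theta>.
  As \<open>N\<close> does not occur in it, the involution hypothesis enters only through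
  \<open>P_NS_eq_sandwich\<close>.\<close>

definition sandwich :: 'm where
  "sandwich = \<mu> \<odot> (\<mu> \<otimes> \<one> A) \<odot> (\<one> A \<otimes> \<sigma> A A) \<odot> (\<theta> \<otimes> \<one> A)"

lemma sandwich_type [simp]:
  "sandwich \<in> Mor C" "Dom C sandwich = A" "Cod C sandwich = A"
  by (simp_all add: sandwich_def)

lemma nakayama_eq: "N = ((\<epsilon> \<odot> \<mu>) \<otimes> \<one> A) \<odot> (\<one> A \<otimes> (\<sigma> A A \<odot> \<theta>))"
  by (simp add: nakayama_def frobenius_pairing_def interchange flip: copairing_def)

lemma nakayama_type [simp]: "N \<in> Mor C" "Dom C N = A" "Cod C N = A"
  by (simp_all add: nakayama_eq)

text \<open>For a second copy \<Sum> e' \<otimes> f' of \<theta>, N x = \<Sum> b(x, f') e'. So the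
  left side is \<Sum> e b(f, f') \<otimes> e', and \<open>snake\<close> contracts the first copy,
  leaving \<Sum> f' \<otimes> e'.\<close>

lemma nakayama_copairing: "(\<one> A \<otimes> N) \<odot> \<theta> = \<sigma> A A \<odot> \<theta>"
proof -
  let ?\<tau> = "\<sigma> A A \<odot> \<theta>" and ?b = "\<epsilon> \<odot> \<mu>"
  have "\<one> A \<otimes> N = (\<one> A \<otimes> ?b \<otimes> \<one> A) \<odot> (\<one> A \<otimes> \<one> A \<otimes> ?\<tau>)"
    by (simp add: nakayama_eq interchange)
  \<comment> \<open>The factor \<open>\<one> \<I>\<close> gives \<open>\<theta>\<close> the tensor
    shape needed by \<open>interchange\<close>. The two copairings can then be created in the
    opposite order.\<close>
  then have "(\<one> A \<otimes> N) \<odot> \<theta> = (\<one> A \<otimes> ?b \<otimes> \<one> A) \<odot> ((\<one> A \<otimes> \<one> A) \<otimes> ?\<tau>) \<odot> (\<theta> \<otimes> \<one> \<I>)"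
    by (simp add: Comp_assoc')
  also have "((\<one> A \<otimes> \<one> A) \<otimes> ?\<tau>) \<odot> (\<theta> \<otimes> \<one> \<I>) = \<theta> \<otimes> ?\<tau>"
    by (simp add: interchange Tensor_Id del: Tensor_unit_right Tensor_assoc)
  also have "\<theta> \<otimes> ?\<tau> = (\<theta> \<otimes> \<one> A \<otimes> \<one> A) \<odot> (\<one> \<I> \<otimes> ?\<tau>)"
    by (simp add: interchange Tensor_Id del: Tensor_unit_left)
  also have "(\<one> A \<otimes> ?b \<otimes> \<one> A) \<odot> \<dots>
      = (((\<one> A \<otimes> ?b) \<otimes> \<one> A) \<odot> ((\<theta> \<otimes> \<one> A) \<otimes> \<one> A)) \<odot> ?\<tau>"
    by (simp add: Comp_assoc')
  also have "\<dots> = (\<one> A \<otimes> \<one> A) \<odot> ?\<tau>"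
    by (simp add: interchange snake del: Tensor_assoc)
  finally show ?thesis
    by (simp add: Tensor_Id)
qed

lemma P_NS_eq_sandwich:
  assumes inv: "N \<odot> N = \<one> A"
  shows "P_NS C A \<mu> \<eta> \<Delta> \<epsilon> = sandwich"
proof -
  \<comment> \<open>Both sides equal
    \<open>(\<one> A \<otimes> N) \<odot> \<sigma> A A \<odot> \<theta>\<close>: the left by
    naturality, the right by \<open>nakayama_copairing\<close>.\<close>
  have "\<sigma> A A \<odot> (N \<otimes> \<one> A) \<odot> \<theta> = (\<one> A \<otimes> N) \<odot> (\<one> A \<otimes> N) \<odot> \<theta>"
    by (simp add: Braiding_nat Comp_assoc' nakayama_copairing flip: Comp_assoc'[of _ _ "\<sigma> A A"])
  also have "\<dots> = \<theta>"
    by (simp add: interchange inv Tensor_Id flip: Comp_assoc')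
  finally have twist: "\<sigma> A A \<odot> (N \<otimes> \<one> A) \<odot> \<theta> = \<theta>" .
  have "(N \<otimes> \<one> A) \<odot> \<Delta> = ((N \<otimes> \<one> A) \<odot> (\<one> A \<otimes> \<mu>)) \<odot> (\<theta> \<otimes> \<one> A)"
    by (simp add: Comp_assoc' comult_copairing_left)
  also have "(N \<otimes> \<one> A) \<odot> (\<one> A \<otimes> \<mu>) = (\<one> A \<otimes> \<mu>) \<odot> ((N \<otimes> \<one> A) \<otimes> \<one> A)"
    by (simp add: interchange Tensor_Id)
  also have "\<dots> \<odot> (\<theta> \<otimes> \<one> A) = (\<one> A \<otimes> \<mu>) \<odot> (((N \<otimes> \<one> A) \<odot> \<theta>) \<otimes> \<one> A)"
    by (simp add: Comp_assoc' interchange del: Tensor_assoc)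
  finally have "\<sigma> A A \<odot> (N \<otimes> \<one> A) \<odot> \<Delta>
      = (\<sigma> A A \<odot> (\<one> A \<otimes> \<mu>)) \<odot> (((N \<otimes> \<one> A) \<odot> \<theta>) \<otimes> \<one> A)"
    by (simp add: Comp_assoc')
  \<comment> \<open>In \<Sum> N e \<otimes> f x the hexagon lets N e cross f first and x afterwards.
    The first crossing is the left side of \<open>twist\<close>, so it restores \<theta>.\<close>
  also have "\<sigma> A A \<odot> (\<one> A \<otimes> \<mu>) = (\<mu> \<otimes> \<one> A) \<odot> (\<one> A \<otimes> \<sigma> A A) \<odot> (\<sigma> A A \<otimes> \<one> A)"
    by (simp add: Braiding_nat Braiding_hexagon1)
  also have "\<dots> \<odot> (((N \<otimes> \<one> A) \<odot> \<theta>) \<otimes> \<one> A) = (\<mu> \<otimes> \<one> A) \<odot> (\<one> A \<otimes> \<sigma> A A) \<odot> (\<theta> \<otimes> \<one> A)"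
    by (simp add: Comp_assoc' interchange twist)
  finally show ?thesis
    by (simp add: P_NS_def sandwich_def)
qed

text \<open>For x \<otimes> a, both a (\<Sum> e x f) and (\<Sum> e x f) a equal \<Sum> a' x a'',
  where \<Delta> a = \<Sum> a' \<otimes> a''. This is \<open>?M\<close>, reached from the two
  copairing formulas for \<Delta> a.\<close>

lemma sandwich_centralising: "centralising C A \<mu> sandwich"
proof -
  let ?M = "\<mu> \<odot> (\<mu> \<otimes> \<one> A) \<odot> (\<one> A \<otimes> \<sigma> A A) \<odot> (\<Delta> \<otimes> \<one> A) \<odot> \<sigma> A A"
  have "\<one> A \<otimes> sandwich = (\<one> A \<otimes> \<mu>) \<odot> (\<one> A \<otimes> \<mu> \<otimes> \<one> A)
      \<odot> (\<one> A \<otimes> \<one> A \<otimes> \<sigma> A A) \<odot> (\<one> A \<otimes> \<theta> \<otimes> \<one> A)"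
    by (simp add: sandwich_def interchange)
  then have "\<mu> \<odot> (\<one> A \<otimes> sandwich) = (\<mu> \<odot> (\<one> A \<otimes> \<mu>) \<odot> (\<one> A \<otimes> \<mu> \<otimes> \<one> A))
      \<odot> (\<one> A \<otimes> \<one> A \<otimes> \<sigma> A A) \<odot> (\<one> A \<otimes> \<theta> \<otimes> \<one> A)"
    by (simp add: Comp_assoc')
  also have "\<dots> = \<mu> \<odot> (\<mu> \<otimes> \<one> A)
      \<odot> ((\<mu> \<otimes> \<one> A \<otimes> \<one> A) \<odot> ((\<one> A \<otimes> \<one> A) \<otimes> \<sigma> A A)) \<odot> (\<one> A \<otimes> \<theta> \<otimes> \<one> A)"
    by (simp add: mult_mult_mult Comp_assoc')
  \<comment> \<open>Form a e before x crosses f, so that \<mu> meets \<theta> directly and yields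
    \<Delta> a.\<close>
  also have "(\<mu> \<otimes> \<one> A \<otimes> \<one> A) \<odot> ((\<one> A \<otimes> \<one> A) \<otimes> \<sigma> A A)
      = (\<one> A \<otimes> \<sigma> A A) \<odot> ((\<mu> \<otimes> \<one> A) \<otimes> \<one> A)"
    by (simp add: interchange Tensor_Id flip: Tensor_assoc[of "\<one> A" "\<one> A" "\<sigma> A A"])
  also have "\<dots> \<odot> (\<one> A \<otimes> \<theta> \<otimes> \<one> A)
      = (\<one> A \<otimes> \<sigma> A A) \<odot> ((\<mu> \<otimes> \<one> A) \<otimes> \<one> A) \<odot> ((\<one> A \<otimes> \<theta>) \<otimes> \<one> A)"
    by (simp add: Comp_assoc')
  also have "((\<mu> \<otimes> \<one> A) \<otimes> \<one> A) \<odot> ((\<one> A \<otimes> \<theta>) \<otimes> \<one> A) = \<Delta> \<otimes> \<one> A"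
    by (simp add: interchange comult_copairing_right del: Tensor_assoc)
  finally have left: "\<mu> \<odot> \<sigma> A A \<odot> (sandwich \<otimes> \<one> A) = ?M"
    by (simp add: Braiding_nat Comp_assoc' flip: Comp_assoc')

  \<comment> \<open>Symmetry allows two cancelling crossings to be inserted. One of them completes
    the braiding of a product, which is natural in \<mu>; the other swaps x and a.\<close>
  have "(\<one> A \<otimes> \<mu>) \<odot> (\<sigma> A A \<otimes> \<one> A)
      = (\<one> A \<otimes> \<mu>) \<odot> (\<sigma> A A \<otimes> \<one> A) \<odot> (\<one> A \<otimes> (\<sigma> A A \<odot> \<sigma> A A))"
    by (simp add: Braiding_symmetric Tensor_Id)
  also have "\<dots> = (\<one> A \<otimes> \<mu>) \<odot> \<sigma> (A \<otimes>\<^sub>o A) A \<odot> (\<one> A \<otimes> \<sigma> A A)"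
    by (simp add: Braiding_hexagon2 Comp_assoc' interchange)
  also have "\<dots> = (\<sigma> A A \<odot> (\<mu> \<otimes> \<one> A)) \<odot> (\<one> A \<otimes> \<sigma> A A)"
    by (simp add: Braiding_nat Comp_assoc')
  finally have slide: "(\<one> A \<otimes> \<mu>) \<odot> (\<sigma> A A \<otimes> \<one> A)
      = \<sigma> A A \<odot> (\<mu> \<otimes> \<one> A) \<odot> (\<one> A \<otimes> \<sigma> A A)"
    by (simp add: Comp_assoc')

  have "sandwich \<otimes> \<one> A = (\<mu> \<otimes> \<one> A) \<odot> ((\<mu> \<otimes> \<one> A) \<otimes> \<one> A)
      \<odot> ((\<one> A \<otimes> \<sigma> A A) \<otimes> \<one> A) \<odot> ((\<theta> \<otimes> \<one> A) \<otimes> \<one> A)"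
    by (simp add: sandwich_def interchange del: Tensor_assoc)
  then have "\<mu> \<odot> (sandwich \<otimes> \<one> A) = (\<mu> \<odot> (\<mu> \<otimes> \<one> A)) \<odot> (\<mu> \<otimes> \<one> A \<otimes> \<one> A)
      \<odot> (\<one> A \<otimes> \<sigma> A A \<otimes> \<one> A) \<odot> (\<theta> \<otimes> \<one> A \<otimes> \<one> A)"
    by (simp add: Comp_assoc')
  also have "\<dots> = \<mu> \<odot> ((\<one> A \<otimes> \<mu>) \<odot> (\<mu> \<otimes> \<one> A \<otimes> \<one> A))
      \<odot> (\<one> A \<otimes> \<sigma> A A \<otimes> \<one> A) \<odot> (\<theta> \<otimes> \<one> A \<otimes> \<one> A)"
    by (simp add: mult_assoc Comp_assoc')
  also have "(\<one> A \<otimes> \<mu>) \<odot> (\<mu> \<otimes> \<one> A \<otimes> \<one> A) = (\<mu> \<otimes> \<one> A) \<odot> ((\<one> A \<otimes> \<one> A) \<otimes> \<mu>)"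
    by (simp add: interchange Tensor_Id del: Tensor_assoc)
  also have "\<mu> \<odot> \<dots> \<odot> (\<one> A \<otimes> \<sigma> A A \<otimes> \<one> A) \<odot> (\<theta> \<otimes> \<one> A \<otimes> \<one> A)
      = \<mu> \<odot> (\<mu> \<otimes> \<one> A) \<odot> (\<one> A \<otimes> ((\<one> A \<otimes> \<mu>) \<odot> (\<sigma> A A \<otimes> \<one> A))) \<odot> (\<theta> \<otimes> \<one> A \<otimes> \<one> A)"
    by (simp add: Comp_assoc' interchange_Comp)
  also have "\<dots> = \<mu> \<odot> (\<mu> \<otimes> \<one> A) \<odot> (\<one> A \<otimes> \<sigma> A A) \<odot> (\<one> A \<otimes> \<mu> \<otimes> \<one> A)
      \<odot> ((\<one> A \<otimes> \<one> A) \<otimes> \<sigma> A A) \<odot> (\<theta> \<otimes> \<one> A \<otimes> \<one> A)"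
    by (simp add: slide Comp_assoc' interchange_Comp)
  \<comment> \<open>The swap of x and a is disjoint from \<theta>, so it can precede it. This gives
    the final \<sigma> of \<open>?M\<close>, and f a is now ready to form \<Delta> a.\<close>
  also have "((\<one> A \<otimes> \<one> A) \<otimes> \<sigma> A A) \<odot> (\<theta> \<otimes> \<one> A \<otimes> \<one> A)
      = (\<theta> \<otimes> \<one> A \<otimes> \<one> A) \<odot> (\<one> \<I> \<otimes> \<sigma> A A)"
    by (simp add: interchange Tensor_Id del: Tensor_assoc Tensor_unit_left)
  also have "(\<one> A \<otimes> \<mu> \<otimes> \<one> A) \<odot> \<dots>
      = (((\<one> A \<otimes> \<mu>) \<otimes> \<one> A) \<odot> ((\<theta> \<otimes> \<one> A) \<otimes> \<one> A)) \<odot> \<sigma> A A"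
    by (simp add: Comp_assoc')
  also have "\<dots> = (\<Delta> \<otimes> \<one> A) \<odot> \<sigma> A A"
    by (simp add: interchange comult_copairing_left del: Tensor_assoc)
  finally have "\<mu> \<odot> (sandwich \<otimes> \<one> A) = ?M" .
  with left show ?thesis
    by (simp add: centralising_def)
qed

lemma centralising_Comp:
  assumes "centralising C A \<mu> c" "c \<in> Hom C V A" "f \<in> Hom C U V"
  shows "centralising C A \<mu> (c \<odot> f)"
proof -
  have [simp]: "c \<in> Mor C" "Dom C c = V" "Cod C c = A" "f \<in> Mor C" "Dom C f = U" "Cod C f = V"
    "U \<in> Obj C" "V \<in> Obj C"
    using assms(2,3) by (auto simp: Hom_iff)
  have cf: "(c \<odot> f) \<otimes> \<one> A = (c \<otimes> \<one> A) \<odot> (f \<otimes> \<one> A)"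
    by (simp add: interchange)
  have "(\<mu> \<odot> \<sigma> A A \<odot> (c \<otimes> \<one> A)) \<odot> (f \<otimes> \<one> A) = (\<mu> \<odot> (c \<otimes> \<one> A)) \<odot> (f \<otimes> \<one> A)"
    using assms(1) by (simp add: centralising_def)
  then show ?thesis
    by (simp add: centralising_def cf Comp_assoc')
qed

text \<open>For central x, \<Sum> e x f = \<Sum> e f x = (\<Sum> e f) x = x.\<close>

lemma sandwich_fixes_centralising:
  assumes sep: "Delta_separable C \<mu> \<eta> \<Delta>" and d: "d \<in> Hom C D A"
    and cent: "centralising C A \<mu> d"
  shows "sandwich \<odot> d = d"
proof -
  have [simp]: "d \<in> Mor C" "Dom C d = D" "Cod C d = A" "D \<in> Obj C"
    using d by (auto simp: Hom_iff)
  \<comment> \<open>\<open>centralising\<close> has \<open>d\<close> on the left strand, but in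
    \<open>sandwich\<close> it enters to the right of f. Braiding and cancelling the double crossing
    gives the mirror form.\<close>
  have "\<mu> \<odot> \<sigma> A A \<odot> (\<one> A \<otimes> d) = (\<mu> \<odot> (d \<otimes> \<one> A)) \<odot> \<sigma> A D"
    by (simp add: Braiding_nat Comp_assoc')
  also have "\<dots> = (\<mu> \<odot> \<sigma> A A \<odot> (d \<otimes> \<one> A)) \<odot> \<sigma> A D"
    using cent by (simp add: centralising_def)
  also have "\<dots> = \<mu> \<odot> \<sigma> A A \<odot> \<sigma> A A \<odot> (\<one> A \<otimes> d)"
    by (simp add: Braiding_nat[of "\<one> A" d] Comp_assoc')
  also have "\<dots> = \<mu> \<odot> (\<one> A \<otimes> d)"
    by (simp add: Braiding_symmetric flip: Comp_assoc'[of _ "\<sigma> A A" "\<sigma> A A"])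
  finally have comm: "\<mu> \<odot> \<sigma> A A \<odot> (\<one> A \<otimes> d) = \<mu> \<odot> (\<one> A \<otimes> d)" .

  have push: "(\<theta> \<otimes> \<one> A) \<odot> d = ((\<one> A \<otimes> \<one> A) \<otimes> d) \<odot> (\<theta> \<otimes> \<one> D)"
  proof -
    have "(\<theta> \<otimes> \<one> A) \<odot> (\<one> \<I> \<otimes> d) = ((\<one> A \<otimes> \<one> A) \<otimes> d) \<odot> (\<theta> \<otimes> \<one> D)"
      by (simp add: interchange Tensor_Id del: Tensor_assoc Tensor_unit_left)
    then show ?thesis
      by simp
  qed
  have "sandwich \<odot> d
      = (\<mu> \<odot> (\<mu> \<otimes> \<one> A)) \<odot> (\<one> A \<otimes> \<sigma> A A) \<odot> (\<one> A \<otimes> \<one> A \<otimes> d) \<odot> (\<theta> \<otimes> \<one> D)"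
    by (simp add: sandwich_def Comp_assoc' push)
  also have "\<dots> = \<mu> \<odot> (\<one> A \<otimes> (\<mu> \<odot> \<sigma> A A \<odot> (\<one> A \<otimes> d))) \<odot> (\<theta> \<otimes> \<one> D)"
    by (simp add: mult_assoc Comp_assoc' interchange_Comp)
  also have "\<dots> = \<mu> \<odot> (\<one> A \<otimes> \<mu>) \<odot> ((\<one> A \<otimes> \<one> A) \<otimes> d) \<odot> (\<theta> \<otimes> \<one> D)"
    by (simp add: comm Comp_assoc' interchange_Comp)
  also have "\<dots> = (\<mu> \<odot> (\<one> A \<otimes> \<mu>)) \<odot> (\<theta> \<otimes> \<one> A) \<odot> d"
    by (simp add: push Comp_assoc')
  also have "\<dots> = (\<mu> \<odot> (\<mu> \<otimes> \<one> A) \<odot> (\<theta> \<otimes> \<one> A)) \<odot> d"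
    by (simp add: Comp_assoc' flip: mult_assoc)
  \<comment> \<open>Separability is \<Sum> e f = \<eta>, since \<open>\<theta>\<close> is
    \<open>\<Delta> \<odot> \<eta>\<close>.\<close>
  also have "\<dots> = (\<mu> \<odot> (\<eta> \<otimes> \<one> A)) \<odot> d"
    using sep by (simp add: interchange Delta_separable_def copairing_def)
  finally show ?thesis
    by (simp add: mult_unit_left)
qed

end

theorem lemma4p21:
  fixes C :: "('o, 'm, 'z) braided_category_scheme" (structure)
    and A Z :: 'o and \<mu> \<eta> \<Delta> \<epsilon> \<iota> \<pi> :: 'm
  assumes "symmetric_strict_monoidal_category C"
    and "frobenius_algebra C A \<mu> \<eta> \<Delta> \<epsilon>"
    and "Delta_separable C \<mu> \<eta> \<Delta>"
    and "nakayama C A \<mu> \<eta> \<Delta> \<epsilon> \<odot> nakayama C A \<mu> \<eta> \<Delta> \<epsilon> = \<one> A"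
    and "is_splitting C A (P_NS C A \<mu> \<eta> \<Delta> \<epsilon>) Z \<iota> \<pi>"
  shows "is_centre C A \<mu> Z \<iota>"
proof -
  interpret symmetric_frobenius_algebra C A \<mu> \<eta> \<Delta> \<epsilon>
    using assms(1,2) by (simp add: symmetric_frobenius_algebra_def)
  have split: "is_splitting C A sandwich Z \<iota> \<pi>"
    using assms(5) by (simp add: P_NS_eq_sandwich[OF assms(4)])
  then have \<iota>: "\<iota> \<in> Hom C Z A" and \<pi>: "\<pi> \<in> Hom C A Z"
    and P: "\<iota> \<odot> \<pi> = sandwich" and r: "\<pi> \<odot> \<iota> = \<one> Z"
    by (auto simp: is_splitting_def)
  \<comment> \<open>This exhibits \<iota> as a precomposite of \<open>sandwich\<close>, from which
    it inherits centrality.\<close>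
  have "sandwich \<odot> \<iota> = \<iota>"
    using Comp_assoc[OF \<iota> \<pi> \<iota>] \<iota> by (simp add: P r Comp_Id_right)
  then have "centralising C A \<mu> \<iota>"
    using centralising_Comp[OF sandwich_centralising _ \<iota>] by (simp add: Hom_iff)
  moreover have "\<exists>!f. f \<in> Hom C D Z \<and> d = \<iota> \<odot> f"
    if "d \<in> Hom C D A" "centralising C A \<mu> d" for D d
    using that splitting_factor_iff[OF split] sandwich_fixes_centralising[OF assms(3)] by simp
  ultimately show ?thesis
    using \<iota> by (simp add: is_centre_def)
qed

end
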